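(* Let $\Gamma,\Delta$ be countable groups, let $b_0$ be a measure preserving action of $\Gamma$ on a standard probability space $(X,\mu)$ with orbit equivalence relation $F=E^X_\Gamma$, and let $a_0$ be a free measure preserving action of $\Delta$ on $(X,\mu)$ with orbit equivalence relation $E=E^X_\Delta\subseteq F$, such that there is a fixed number $N\in\{1,2,\dots,\aleph_0\}$ of $E$-classes in each $F$-class; let $\{C_n\}_{n\in N}$ be choice functions for $E\subseteq F$. If for some $k,n\in N$ we have $\inf_{\gamma\in\Gamma}\varphi^{k,n}_E(\gamma)>0$, then for any measure preserving action $a$ of $\Delta$ on a standard probability space $(Y,\nu)$: if the co-induced action $b=\mathrm{CInd}(a_0,b_0)^\Gamma_\Delta(a)$ is ergodic, then $a$ is ergodic.
   Context: Standard probability space: isomorphic to $[0,1]$ with Lebesgue measure; everything is modulo null sets. Identify $N$ with $\{0,\dots,N-1\}$ if finite and with $\mathbb N$ if $N=\aleph_0$. Choice functions are Borel functions $C_n:X\to X$ ($n\in N$) with $C_0=\mathrm{id}$ such that for each $x$ the points $C_n(x)$, $n\in N$, are distinct and form a transversal for the $E$-classes contained in $[x]_F$ (if $a_0$ is ergodic, the $C_n$ are taken to be one-to-one, which is possible). For $\gamma\in\Gamma$ and $k,n\in N$, $\varphi^{k,n}_E(\gamma)=\mu(\{x: C_k(x)\,E\,C_n(\gamma\cdot x)\})$; so $\varphi^{0,0}_E(\gamma)=\varphi_E(\gamma)=\mu(\{x:\gamma\cdot x\,E\,x\})$. Co-induced action. For $\gamma\in\Gamma$, $x\in X$ let $\pi(\gamma,x)$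 be the permutation of $N$ defined by $\pi(\gamma,x)(k)=n\Leftrightarrow [C_k(x)]_E=[C_n(\gamma\cdot x)]_E$, and for $n\in N$ let $\bar\delta(\gamma,x)_n$ be the unique element of $\Delta$ with $\bar\delta(\gamma,x)_n\cdot C_{\pi(\gamma,x)^{-1}(n)}(x)=C_n(\gamma\cdot x)$ (action $a_0$). Given a measure preserving action $a$ of $\Delta$ on $(Y,\nu)$, $\mathrm{CInd}(a_0,b_0)^\Gamma_\Delta(a)$ is the measure preserving action of $\Gamma$ on $(X\times Y^N,\mu\times\nu^N)$ given by $\gamma\cdot(x,\bar y)=(\gamma\cdot x,\ (n\mapsto \bar\delta(\gamma,x)_n\cdot \bar y_{\pi(\gamma,x)^{-1}(n)}))$, where $\Delta$ acts on $Y$ by $a$. *)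

theory Defs
  imports
    "HOL-Probability.Probability"
    "HOL-Library.Extended_Nat"
    "HOL-Library.Equipollence"
    "HOL-Algebra.Group_Action"
begin

text \<open>
  Group actions are genuine (everywhere defined) Borel actions; since the groups are countable,
  every action modulo null sets agrees almost everywhere with one of these.  All further
  hypotheses (freeness, inclusion of the equivalence relations, number of classes, choice
  functions, invariance of sets) are imposed only almost everywhere.
\<close>

text \<open>
  The isomorphism is one of Borel structures, so that \<open>sets M\<close> is the Borel \<open>\<sigma>\<close>-algebra of a
  standard Borel space and \<open>measurable M M\<close> is the set of Borel functions.
\<close>

definition standard_prob_space :: "'x measure \<Rightarrow> bool" where
  "standard_prob_space M \<longleftrightarrow>
     (let U = restrict_space lborel {0..1::real} in
      \<exists>f g. f \<in> measurable M U \<and> g \<in> measurable U M \<and>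
        (\<forall>x\<in>space M. g (f x) = x) \<and> (\<forall>t\<in>space U. f (g t) = t) \<and>
        distr M U f = U)"

definition pmp_action :: "('g, 'm) monoid_scheme \<Rightarrow> 'x measure \<Rightarrow> ('g \<Rightarrow> 'x \<Rightarrow> 'x) \<Rightarrow> bool" where
  "pmp_action G M \<alpha> \<longleftrightarrow>
     group_action G (space M) \<alpha> \<and>
     (\<forall>g\<in>carrier G. \<alpha> g \<in> measurable M M \<and> distr M M (\<alpha> g) = M)"

definition free_action :: "('g, 'm) monoid_scheme \<Rightarrow> 'x measure \<Rightarrow> ('g \<Rightarrow> 'x \<Rightarrow> 'x) \<Rightarrow> bool" where
  "free_action G M \<alpha> \<longleftrightarrow>
     (AE x in M. \<forall>g\<in>carrier G. \<alpha> g x = x \<longrightarrow> g = \<one>\<^bsub>G\<^esub>)"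

text \<open>
  Invariance is modulo null sets; the definition also makes sense for maps that form an
  action only modulo null sets, such as the co-induced ones below.
\<close>

definition ergodic :: "('g, 'm) monoid_scheme \<Rightarrow> 'x measure \<Rightarrow> ('g \<Rightarrow> 'x \<Rightarrow> 'x) \<Rightarrow> bool" where
  "ergodic G M \<alpha> \<longleftrightarrow>
     (\<forall>A\<in>sets M. (\<forall>g\<in>carrier G. AE x in M. \<alpha> g x \<in> A \<longleftrightarrow> x \<in> A) \<longrightarrow>
        measure M A = 0 \<or> measure M A = 1)"

definition orbit_rel :: "('g, 'm) monoid_scheme \<Rightarrow> 'x measure \<Rightarrow> ('g \<Rightarrow> 'x \<Rightarrow> 'x) \<Rightarrow> 'x rel" where
  "orbit_rel G M \<alpha> = {(x, y). x \<in> space M \<and> y \<in> orbit G \<alpha> x}"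

definition subrel_ae :: "'x measure \<Rightarrow> 'x rel \<Rightarrow> 'x rel \<Rightarrow> bool" where
  "subrel_ae M E F \<longleftrightarrow> (AE x in M. E `` {x} \<subseteq> F `` {x})"

text \<open>The \<open>E\<close>-classes contained in the \<open>F\<close>-class of \<open>x\<close>.\<close>

definition classes_below :: "'x measure \<Rightarrow> 'x rel \<Rightarrow> 'x rel \<Rightarrow> 'x \<Rightarrow> 'x set set" where
  "classes_below M E F x = {K \<in> space M // E. K \<subseteq> F `` {x}}"

text \<open>
  The identification of \<open>N\<close> with \<open>{0, \<dots>, N - 1}\<close> if \<open>N\<close> is finite and with the set of all
  natural numbers if \<open>N = \<infinity>\<close>, i.e. \<open>N\<close> is countably infinite.
\<close>

definition index_set :: "enat \<Rightarrow> nat set" where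
  "index_set N = {n. enat n < N}"

definition has_index :: "'x measure \<Rightarrow> 'x rel \<Rightarrow> 'x rel \<Rightarrow> enat \<Rightarrow> bool" where
  "has_index M E F N \<longleftrightarrow> (AE x in M. classes_below M E F x \<approx> index_set N)"

definition transversal :: "'x set \<Rightarrow> 'x set set \<Rightarrow> bool" where
  "transversal T \<K> \<longleftrightarrow> T \<subseteq> \<Union>\<K> \<and> (\<forall>K\<in>\<K>. \<exists>!t. t \<in> T \<inter> K)"

text \<open>
  Choice functions for \<open>E \<subseteq> F\<close>, where \<open>E\<close> and \<open>F\<close> are the orbit equivalence relations of the
  action \<open>\<alpha>\<^sub>0\<close> of \<open>D\<close> and of the action \<open>\<beta>\<^sub>0\<close> of \<open>G\<close>.  The last conjunct is the convention that
  they are taken to be one-to-one (modulo a null set) when \<open>\<alpha>\<^sub>0\<close> is ergodic.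
\<close>

definition choice_functions ::
  "('g, 'm) monoid_scheme \<Rightarrow> ('d, 'n) monoid_scheme \<Rightarrow> 'x measure \<Rightarrow>
   ('d \<Rightarrow> 'x \<Rightarrow> 'x) \<Rightarrow> ('g \<Rightarrow> 'x \<Rightarrow> 'x) \<Rightarrow> enat \<Rightarrow> (nat \<Rightarrow> 'x \<Rightarrow> 'x) \<Rightarrow> bool" where
  "choice_functions G D M \<alpha>\<^sub>0 \<beta>\<^sub>0 N C \<longleftrightarrow>
     (\<forall>n\<in>index_set N. C n \<in> measurable M M) \<and>
     (AE x in M. C 0 x = x) \<and>
     (AE x in M. inj_on (\<lambda>n. C n x) (index_set N) \<and>
        transversal ((\<lambda>n. C n x) ` index_set N)
          (classes_below M (orbit_rel D M \<alpha>\<^sub>0) (orbit_rel G M \<beta>\<^sub>0) x)) \<and>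
     (ergodic D M \<alpha>\<^sub>0 \<longrightarrow>
        (\<forall>n\<in>index_set N. \<exists>Z\<in>null_sets M. inj_on (C n) (space M - Z)))"

text \<open>\<open>phi_coeff M E \<beta>\<^sub>0 C k n\<close> is the function \<open>\<phi>\<^sub>E\<close> with upper indices \<open>k, n\<close>.\<close>

definition phi_coeff ::
  "'x measure \<Rightarrow> 'x rel \<Rightarrow> ('g \<Rightarrow> 'x \<Rightarrow> 'x) \<Rightarrow> (nat \<Rightarrow> 'x \<Rightarrow> 'x) \<Rightarrow> nat \<Rightarrow> nat \<Rightarrow> 'g \<Rightarrow> real" where
  "phi_coeff M E \<beta>\<^sub>0 C k n \<gamma> = measure M {x \<in> space M. (C k x, C n (\<beta>\<^sub>0 \<gamma> x)) \<in> E}"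

definition coind_perm ::
  "'x rel \<Rightarrow> ('g \<Rightarrow> 'x \<Rightarrow> 'x) \<Rightarrow> enat \<Rightarrow> (nat \<Rightarrow> 'x \<Rightarrow> 'x) \<Rightarrow> 'g \<Rightarrow> 'x \<Rightarrow> nat \<Rightarrow> nat" where
  "coind_perm E \<beta>\<^sub>0 N C \<gamma> x k =
     (THE n. n \<in> index_set N \<and> E `` {C k x} = E `` {C n (\<beta>\<^sub>0 \<gamma> x)})"

definition coind_perm_inv ::
  "'x rel \<Rightarrow> ('g \<Rightarrow> 'x \<Rightarrow> 'x) \<Rightarrow> enat \<Rightarrow> (nat \<Rightarrow> 'x \<Rightarrow> 'x) \<Rightarrow> 'g \<Rightarrow> 'x \<Rightarrow> nat \<Rightarrow> nat" where
  "coind_perm_inv E \<beta>\<^sub>0 N C \<gamma> x = inv_into (index_set N) (coind_perm E \<beta>\<^sub>0 N C \<gamma> x)"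

definition coind_delta ::
  "('d, 'n) monoid_scheme \<Rightarrow> 'x measure \<Rightarrow> ('d \<Rightarrow> 'x \<Rightarrow> 'x) \<Rightarrow> ('g \<Rightarrow> 'x \<Rightarrow> 'x) \<Rightarrow> enat \<Rightarrow>
   (nat \<Rightarrow> 'x \<Rightarrow> 'x) \<Rightarrow> 'g \<Rightarrow> 'x \<Rightarrow> nat \<Rightarrow> 'd" where
  "coind_delta D M \<alpha>\<^sub>0 \<beta>\<^sub>0 N C \<gamma> x n =
     (THE \<delta>. \<delta> \<in> carrier D \<and>
        \<alpha>\<^sub>0 \<delta> (C (coind_perm_inv (orbit_rel D M \<alpha>\<^sub>0) \<beta>\<^sub>0 N C \<gamma> x n) x) = C n (\<beta>\<^sub>0 \<gamma> x))"

definition coind_space :: "'x measure \<Rightarrow> 'y measure \<Rightarrow> enat \<Rightarrow> ('x \<times> (nat \<Rightarrow> 'y)) measure" where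
  "coind_space M Q N = M \<Otimes>\<^sub>M (\<Pi>\<^sub>M n\<in>index_set N. Q)"

text \<open>
  The co-induced action of the action \<open>a\<close> of \<open>D\<close>, as a family of maps on \<open>coind_space M Q N\<close>.
  The permutation and the elements of \<open>D\<close> entering it are well defined for almost every \<open>x\<close>
  (and arbitrary on the exceptional null set).
\<close>

definition coind_action ::
  "('d, 'n) monoid_scheme \<Rightarrow> 'x measure \<Rightarrow> ('d \<Rightarrow> 'x \<Rightarrow> 'x) \<Rightarrow> ('g \<Rightarrow> 'x \<Rightarrow> 'x) \<Rightarrow> enat \<Rightarrow>
   (nat \<Rightarrow> 'x \<Rightarrow> 'x) \<Rightarrow> ('d \<Rightarrow> 'y \<Rightarrow> 'y) \<Rightarrow> 'g \<Rightarrow> 'x \<times> (nat \<Rightarrow> 'y) \<Rightarrow> 'x \<times> (nat \<Rightarrow> 'y)" where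
  "coind_action D M \<alpha>\<^sub>0 \<beta>\<^sub>0 N C a \<gamma> = (\<lambda>(x, y).
     (\<beta>\<^sub>0 \<gamma> x,
      \<lambda>n\<in>index_set N. a (coind_delta D M \<alpha>\<^sub>0 \<beta>\<^sub>0 N C \<gamma> x n)
                        (y (coind_perm_inv (orbit_rel D M \<alpha>\<^sub>0) \<beta>\<^sub>0 N C \<gamma> x n))))"

end

theory Submission
  imports Defs
begin

text \<open>
  Let \<open>I\<close> be the index set of the choice functions.  The group \<open>G\<close> acts not only on \<open>X\<close> but also
  on \<open>X \<times> I\<close>, by \<open>\<gamma> (x, m) = (\<gamma> x, \<pi>(\<gamma>, x) m)\<close>; a point of this space is a point \<open>x\<close> together with
  an \<open>E\<close>-class inside \<open>[x]\<^sub>F\<close>.  This action preserves the (possibly infinite) product \<open>Z\<close> of \<open>\<mu>\<close> with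
  counting measure, and \<open>\<phi>\<^sup>k\<^sup>,\<^sup>n(\<gamma>)\<close> is the measure of the set of points of the layer \<open>X \<times> {k}\<close> that \<open>\<gamma>\<close>
  moves into the layer \<open>X \<times> {n}\<close>.

  A positive lower bound \<open>\<epsilon>\<close> of \<open>\<phi>\<^sup>k\<^sup>,\<^sup>n\<close> therefore says that all translates of the indicator of
  \<open>X \<times> {n}\<close> have inner product at least \<open>\<epsilon>\<close> with the indicator of \<open>X \<times> {k}\<close>.  As in the proof of the
  mean ergodic theorem, an element of minimal norm in a closed convex set of functions with
  this property, invariant under translation, is itself an invariant function: this gives a
  \<open>G\<close>-invariant integrable function \<open>h\<close> on \<open>X \<times> I\<close> with \<open>\<integral> h(x, k) d\<mu> \<ge> \<epsilon>\<close> (\<open>convex_min_norm_limit\<close> and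
  \<open>invariant_weight\<close>).

  Let \<open>A\<close> be invariant under \<open>a\<close> and put \<open>f = 1\<^sub>A - \<nu>(A)\<close>.  Since \<open>f\<close> is invariant under the elements of
  \<open>D\<close> in the co-induced action, that action only permutes the numbers \<open>f(y\<^sub>m)\<close>, in the same way as
  \<open>G\<close> permutes the indices in \<open>X \<times> I\<close>.  Hence
  \<open>\<Phi>(x, y) = \<Sum>\<^sub>m h(x, m) f(y\<^sub>m)\<close> is invariant under the co-induced action.  For almost every \<open>x\<close> the
  function \<open>\<Phi>(x, \<cdot>)\<close> has mean zero, so ergodicity, applied to \<open>{\<Phi> > 0}\<close>, forces \<open>\<Phi> = 0\<close> almost
  everywhere.  But the coordinates are independent, so (\<open>weighted_coordinate_sum\<close>)
  \<open>0 = \<integral> \<Phi>(x, y) f(y\<^sub>k) dy = h(x, k) \<nu>(A) (1 - \<nu>(A))\<close>, and \<open>h(\<cdot>, k)\<close> does not vanish almost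
  everywhere.  Thus \<open>\<nu>(A)\<close> is \<open>0\<close> or \<open>1\<close>.
\<close>

section \<open>Elements of minimal norm\<close>

text \<open>
  By the inequality \<open>|t| \<le> 2\<^sup>j t\<^sup>2 + 2\<^sup>-\<^sup>j\<close>, the weighted squares \<open>2\<^sup>j d\<^sub>j\<^sup>2\<close> control the absolute values, and
  their sum has finite integral.  Comparing the absolute values with the squares directly keeps
  the statement valid on spaces of infinite measure, where \<open>L\<^sup>2\<close> is not contained in \<open>L\<^sup>1\<close>.
\<close>

lemma AE_summable_if_square_integrals_decay:
  fixes d :: "nat \<Rightarrow> 'z \<Rightarrow> real"
  assumes [measurable]: "\<And>j. d j \<in> borel_measurable Z"
    and int: "\<And>j. integrable Z (\<lambda>z. (d j z)\<^sup>2)"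
    and decay: "\<And>j. (\<integral>z. (d j z)\<^sup>2 \<partial>Z) \<le> c / 4 ^ j"
  shows "AE z in Z. summable (\<lambda>j. \<bar>d j z\<bar>)"
proof -
  have le: "(\<integral>\<^sup>+z. ennreal (2 ^ j * (d j z)\<^sup>2) \<partial>Z) \<le> ennreal (c * (1/2) ^ j)" for j
  proof -
    have "(\<integral>\<^sup>+z. ennreal (2 ^ j * (d j z)\<^sup>2) \<partial>Z) = ennreal (\<integral>z. 2 ^ j * (d j z)\<^sup>2 \<partial>Z)"
      using int by (intro nn_integral_eq_integral) auto
    also have "\<dots> = ennreal (2 ^ j * (\<integral>z. (d j z)\<^sup>2 \<partial>Z))"
      by simp
    also have "\<dots> \<le> ennreal (2 ^ j * (c / 4 ^ j))"
      using decay[of j] by (intro ennreal_leI mult_left_mono) auto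
    also have "2 ^ j * (c / 4 ^ j) = c * (1/2) ^ j"
      by (simp add: power_divide field_simps flip: power_mult_distrib)
    finally show ?thesis .
  qed
  have c0: "0 \<le> c"
    using order_trans[OF integral_nonneg_AE decay[of 0]] by simp
  have sm: "summable (\<lambda>j. c * (1/2::real) ^ j)"
    by (intro summable_mult summable_geometric) auto
  have "(\<integral>\<^sup>+z. (\<Sum>j. ennreal (2 ^ j * (d j z)\<^sup>2)) \<partial>Z) = (\<Sum>j. \<integral>\<^sup>+z. ennreal (2 ^ j * (d j z)\<^sup>2) \<partial>Z)"
    by (rule nn_integral_suminf) measurable
  also have "\<dots> \<le> (\<Sum>j. ennreal (c * (1/2) ^ j))"
    by (intro suminf_le le) auto
  also have "\<dots> = ennreal (\<Sum>j. c * (1/2) ^ j)"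
    using sm c0 by (intro suminf_ennreal2) auto
  also have "\<dots> < \<infinity>" by simp
  finally have "AE z in Z. (\<Sum>j. ennreal (2 ^ j * (d j z)\<^sup>2)) \<noteq> \<infinity>"
    by (intro nn_integral_PInf_AE) auto
  then show ?thesis
  proof eventually_elim
    case (elim z)
    have s1: "summable (\<lambda>j. 2 ^ j * (d j z)\<^sup>2)"
      using elim by (intro summable_suminf_not_top) (auto simp: infinity_ennreal_def)
    have s2: "summable (\<lambda>j. (1/2::real) ^ j)"
      by (intro summable_geometric) auto
    show ?case
    proof (rule summable_comparison_test_ev[OF _ summable_add[OF s1 s2]], intro always_eventually allI)
      fix j
      \<comment> \<open>With \<open>t = 2\<^sup>j |d\<^sub>j|\<close>, this is \<open>t \<le> t\<^sup>2 + 1\<close>.\<close>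
      have "0 \<le> (2 ^ j * \<bar>d j z\<bar> - 1)\<^sup>2 + 2 ^ j * \<bar>d j z\<bar>"
        by simp
      hence "2 ^ j * \<bar>d j z\<bar> \<le> 2 ^ j * 2 ^ j * (d j z)\<^sup>2 + 1"
        by (simp add: power2_diff power_mult_distrib power2_eq_square algebra_simps)
      hence "\<bar>d j z\<bar> \<le> 2 ^ j * (d j z)\<^sup>2 + 1 / 2 ^ j"
        by (simp add: field_simps)
      thus "norm \<bar>d j z\<bar> \<le> 2 ^ j * (d j z)\<^sup>2 + (1/2) ^ j"
        by (simp add: power_divide)
    qed
  qed
qed

text \<open>
  The existence of an element of minimal norm in a closed convex subset of \<open>L\<^sup>2\<close>, stated for
  functions: by the parallelogram law, a sequence \<open>u\<close> in \<open>K\<close> whose squared norms come within \<open>4\<^sup>-\<^sup>j\<close> of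
  their infimum has so small successive differences in \<open>L\<^sup>2\<close> that it converges almost everywhere.  If
  a measure preserving \<open>S\<close> maps \<open>K\<close> to itself by composition, then \<open>u\<^sub>j \<circ> S\<close> is as close to the
  infimum as \<open>u\<^sub>j\<close>, so both have the same limit, which is thus \<open>S\<close>-invariant.  The limit need not
  lie in \<open>K\<close>; whatever is needed of it follows from the convergence.
\<close>

lemma convex_min_norm_limit:
  fixes K :: "('z \<Rightarrow> real) set"
  assumes "K \<noteq> {}"
    and meas: "\<And>g. g \<in> K \<Longrightarrow> g \<in> borel_measurable Z"
    and bd: "\<And>g z. g \<in> K \<Longrightarrow> 0 \<le> g z \<and> g z \<le> 1"
    and int: "\<And>g. g \<in> K \<Longrightarrow> integrable Z g"
    and midpoint: "\<And>g g'. g \<in> K \<Longrightarrow> g' \<in> K \<Longrightarrow> (\<lambda>z. (g z + g' z) / 2) \<in> K"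
  obtains u h where "\<And>j::nat. u j \<in> K" and "h \<in> borel_measurable Z"
    and "\<And>z. 0 \<le> h z \<and> h z \<le> 1"
    and "AE z in Z. (\<lambda>j. u j z) \<longlonglongrightarrow> h z"
    and "\<And>S. \<lbrakk>S \<in> measurable Z Z; distr Z Z S = Z; \<And>g. g \<in> K \<Longrightarrow> (\<lambda>z. g (S z)) \<in> K\<rbrakk>
          \<Longrightarrow> AE z in Z. h (S z) = h z"
proof -
  define q where "q g = (\<integral>z. (g z)\<^sup>2 \<partial>Z)" for g :: "'z \<Rightarrow> real"
  have int2: "integrable Z (\<lambda>z. g z * g' z)" if g: "g \<in> K" "g' \<in> K" for g g'
  proof (rule Bochner_Integration.integrable_bound[OF int[OF g(1)]])
    show "(\<lambda>z. g z * g' z) \<in> borel_measurable Z"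
      using meas[OF g(1)] meas[OF g(2)] by measurable
    show "AE z in Z. norm (g z * g' z) \<le> norm (g z)"
      using bd[OF g(1)] bd[OF g(2)] by (auto simp: abs_mult intro!: mult_left_le)
  qed
  have intd: "integrable Z (\<lambda>z. (g z - g' z)\<^sup>2)" if g: "g \<in> K" "g' \<in> K" for g g'
  proof -
    have "integrable Z (\<lambda>z. g z * g z + g' z * g' z - 2 * (g z * g' z))"
      using int2[OF g] int2[OF g(1) g(1)] int2[OF g(2) g(2)] by simp
    also have "(\<lambda>z. g z * g z + g' z * g' z - 2 * (g z * g' z)) = (\<lambda>z. (g z - g' z)\<^sup>2)"
      by (simp add: power2_eq_square algebra_simps)
    finally show ?thesis .
  qed
  have parallelogram:
    "(\<integral>z. (g z - g' z)\<^sup>2 \<partial>Z) = 2 * q g + 2 * q g' - 4 * q (\<lambda>z. (g z + g' z) / 2)"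
    if g: "g \<in> K" "g' \<in> K" for g g'
  proof -
    define w where "w = (\<lambda>z. (g z + g' z) / 2)"
    have w: "w \<in> K"
      unfolding w_def by (rule midpoint[OF g])
    have "2 * q g + 2 * q g' - 4 * q w
        = (\<integral>z. 2 * (g z * g z) + 2 * (g' z * g' z) - 4 * (w z * w z) \<partial>Z)"
      using int2[OF g(1) g(1)] int2[OF g(2) g(2)] int2[OF w w]
      by (simp add: q_def power2_eq_square)
    also have "\<dots> = (\<integral>z. (g z - g' z)\<^sup>2 \<partial>Z)"
      by (intro Bochner_Integration.integral_cong) (auto simp: w_def power2_eq_square field_simps)
    finally show ?thesis by (simp add: w_def)
  qed
  define m where "m = Inf (q ` K)"
  have q0: "0 \<le> q g" for g
    unfolding q_def by simp
  have m: "m \<le> q g" if "g \<in> K" for g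
    unfolding m_def using that q0 by (auto intro!: cINF_lower bdd_belowI2)
  \<comment> \<open>The midpoint lies in \<open>K\<close>, so the term that the parallelogram law subtracts is at least \<open>4 m\<close>.\<close>
  have close: "(\<integral>z. (g z - g' z)\<^sup>2 \<partial>Z) \<le> 2 * (q g - m) + 2 * (q g' - m)"
    if g: "g \<in> K" "g' \<in> K" for g g'
    using parallelogram[OF g] m[OF midpoint[OF g]] by simp
  have "\<exists>g\<in>K. q g < m + 1 / 4 ^ j" for j :: nat
    using cInf_lessD[of "q ` K" "m + 1 / 4 ^ j"] \<open>K \<noteq> {}\<close> unfolding m_def by auto
  then obtain u where u: "\<And>j. u j \<in> K" "\<And>j. q (u j) < m + 1 / 4 ^ j"
    by metis
  have [measurable]: "u j \<in> borel_measurable Z" for j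
    using meas u by blast
  have "AE z in Z. summable (\<lambda>j. \<bar>u (Suc j) z - u j z\<bar>)"
  proof (rule AE_summable_if_square_integrals_decay[where c = 4])
    fix j
    show "integrable Z (\<lambda>z. (u (Suc j) z - u j z)\<^sup>2)"
      using intd u by blast
    have arith: "i \<le> 4 * e" if "i \<le> 2 * (s - m) + 2 * (t - m)" "s < m + e'" "t < m + e" "e' \<le> e"
      for i s t e e' :: real
      using that by argo
    have "(1::real) / 4 ^ Suc j \<le> 1 / 4 ^ j"
      by (intro divide_left_mono) auto
    from arith[OF close[OF u(1) u(1)] u(2) u(2) this]
    show "(\<integral>z. (u (Suc j) z - u j z)\<^sup>2 \<partial>Z) \<le> 4 / 4 ^ j"
      by simp
  qed measurable
  then have conv: "AE z in Z. convergent (\<lambda>j. u j z)"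
  proof eventually_elim
    case (elim z)
    hence "summable (\<lambda>j. u (Suc j) z - u j z)"
      by (rule summable_rabs_cancel)
    hence "convergent (\<lambda>n. \<Sum>j<n. u (Suc j) z - u j z)"
      by (rule summable_LIMSEQ[THEN convergentI])
    hence "convergent (\<lambda>n. u n z - u 0 z)"
      by (simp add: sum_lessThan_telescope[of "\<lambda>j. u j z"])
    thus ?case
      by (simp add: convergent_diff_const_right_iff)
  qed
  define h where "h z = (if convergent (\<lambda>j. u j z) then lim (\<lambda>j. u j z) else 0)" for z
  have h[measurable]: "h \<in> borel_measurable Z"
    unfolding h_def Cauchy_convergent_iff[symmetric] by measurable
  have lim: "(\<lambda>j. u j z) \<longlonglongrightarrow> h z" if "convergent (\<lambda>j. u j z)" for z
    using that by (simp add: h_def convergent_LIMSEQ_iff)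
  have h01: "0 \<le> h z \<and> h z \<le> 1" for z
  proof (cases "convergent (\<lambda>j. u j z)")
    case True
    show ?thesis
      using LIMSEQ_le_const[OF lim[OF True], of 0] LIMSEQ_le_const2[OF lim[OF True], of 1] bd u(1)
      by blast
  qed (simp add: h_def)
  show thesis
  proof (rule that[OF u(1) h h01])
    show "AE z in Z. (\<lambda>j. u j z) \<longlonglongrightarrow> h z"
      using conv by eventually_elim (rule lim)
    fix S assume S[measurable]: "S \<in> measurable Z Z" and pres: "distr Z Z S = Z"
      and closed: "\<And>g. g \<in> K \<Longrightarrow> (\<lambda>z. g (S z)) \<in> K"
    have qS: "q (\<lambda>z. u j (S z)) = q (u j)" for j
      unfolding q_def using integral_distr[OF S, of "\<lambda>z. (u j z)\<^sup>2"] by (simp add: pres)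
    have "AE z in Z. summable (\<lambda>j. \<bar>u j (S z) - u j z\<bar>)"
    proof (rule AE_summable_if_square_integrals_decay[where c = 4])
      fix j
      show "integrable Z (\<lambda>z. (u j (S z) - u j z)\<^sup>2)"
        using intd[OF closed] u by blast
      show "(\<integral>z. (u j (S z) - u j z)\<^sup>2 \<partial>Z) \<le> 4 / 4 ^ j"
        using close[OF closed[OF u(1)] u(1), of j j] u(2)[of j] by (simp add: qS)
    qed measurable
    moreover have "AE z in Z. convergent (\<lambda>j. u j (S z))"
      by (rule AE_distrD[OF S]) (simp only: pres conv)
    ultimately show "AE z in Z. h (S z) = h z"
      using conv
    proof eventually_elim
      case (elim z)
      have "(\<lambda>j. u j (S z) - u j z) \<longlonglongrightarrow> h (S z) - h z"
        using elim by (intro tendsto_diff lim)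
      moreover have "(\<lambda>j. u j (S z) - u j z) \<longlonglongrightarrow> 0"
        using summable_LIMSEQ_zero[OF elim(1)] by (simp add: tendsto_rabs_zero_iff)
      ultimately show ?case
        using LIMSEQ_unique by fastforce
    qed
  qed
qed

section \<open>Standard probability spaces and actions\<close>

lemma standard_prob_space_imp_prob_space:
  assumes "standard_prob_space M"
  shows "prob_space M"
proof -
  define U where "U = restrict_space lborel {0..1::real}"
  obtain f where f: "f \<in> measurable M U" and d: "distr M U f = U"
    using assms unfolding standard_prob_space_def Let_def U_def[symmetric] by blast
  have "emeasure M (space M) = emeasure (distr M U f) (space U)"
    using measurable_space[OF f] by (subst emeasure_distr[OF f]) (auto intro!: arg_cong[where f = "emeasure M"])
  also have "\<dots> = emeasure U (space U)"
    by (simp only: d)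
  also have "\<dots> = 1"
    by (simp add: U_def emeasure_restrict_space space_restrict_space)
  finally show ?thesis
    by (rule prob_spaceI)
qed

text \<open>A standard Borel space is countably separated, so its diagonal is measurable.\<close>

lemma standard_prob_space_measurable_eq:
  fixes M :: "'x measure" and L :: "'z measure"
  assumes M: "standard_prob_space M"
    and [measurable]: "u \<in> measurable L M" "v \<in> measurable L M"
  shows "{x \<in> space L. u x = v x} \<in> sets L"
proof -
  obtain f :: "'x \<Rightarrow> real" and g where f: "f \<in> measurable M (restrict_space lborel {0..1})"
    and inv: "\<forall>x\<in>space M. g (f x) = x"
    using M unfolding standard_prob_space_def Let_def by blast
  have [measurable]: "f \<in> borel_measurable M"
    using f by (simp add: measurable_restrict_space2_iff)
  have "{x \<in> space L. u x = v x} = {x \<in> space L. f (u x) = f (v x)}"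
    using inv measurable_space[OF assms(2)] measurable_space[OF assms(3)] by metis
  also have "\<dots> \<in> sets L"
    by measurable
  finally show ?thesis .
qed

lemma group_action_inv_cancel:
  assumes "group_action G X \<alpha>" "g \<in> carrier G" "x \<in> X"
  shows "\<alpha> (inv\<^bsub>G\<^esub> g) (\<alpha> g x) = x"
  using group_action.orbit_sym_aux[OF assms(1,2,3) refl] .

lemma group_action_one:
  assumes "group_action G X \<alpha>" "x \<in> X"
  shows "\<alpha> \<one>\<^bsub>G\<^esub> x = x"
  using group_action.id_eq_one[OF assms(1)] assms(2) by (metis restrict_apply')

lemma equiv_orbit_rel:
  assumes "group_action G (space M) \<alpha>"
  shows "equiv (space M) (orbit_rel G M \<alpha>)"
proof (rule equivI)
  interpret group_action G "space M" \<alpha> by fact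
  have mem: "y \<in> space M" if "x \<in> space M" "y \<in> orbit G \<alpha> x" for x y
    using that element_image unfolding orbit_def by blast
  show "orbit_rel G M \<alpha> \<subseteq> space M \<times> space M"
    using mem by (auto simp: orbit_rel_def)
  show "refl_on (space M) (orbit_rel G M \<alpha>)"
    by (auto simp: refl_on_def orbit_rel_def orbit_refl)
  show "sym (orbit_rel G M \<alpha>)"
    by (auto simp: sym_def orbit_rel_def intro: mem orbit_sym)
  show "trans (orbit_rel G M \<alpha>)"
    unfolding trans_def orbit_rel_def using mem orbit_trans by blast
qed

text \<open>
  The relation is the union of the graphs of the countably many maps \<open>\<alpha> d\<close>.
\<close>

lemma measurable_orbit_rel:
  assumes M: "standard_prob_space M" and act: "pmp_action D M \<alpha>" and "countable (carrier D)"
    and u: "u \<in> measurable L M" and v: "v \<in> measurable L M"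
  shows "{x \<in> space L. (u x, v x) \<in> orbit_rel D M \<alpha>} \<in> sets L"
proof -
  have "{x \<in> space L. (u x, v x) \<in> orbit_rel D M \<alpha>} = (\<Union>d\<in>carrier D. {x \<in> space L. \<alpha> d (u x) = v x})"
    using measurable_space[OF u] by (auto simp: orbit_rel_def orbit_def) metis
  also have "\<dots> \<in> sets L"
  proof (rule sets.countable_UN'[OF assms(3)])
    have "{x \<in> space L. \<alpha> d (u x) = v x} \<in> sets L" if "d \<in> carrier D" for d
    proof (rule standard_prob_space_measurable_eq[OF M _ v])
      have "\<alpha> d \<in> measurable M M"
        using act that by (simp add: pmp_action_def)
      thus "(\<lambda>x. \<alpha> d (u x)) \<in> measurable L M"
        using u by measurable
    qed
    thus "(\<lambda>d. {x \<in> space L. \<alpha> d (u x) = v x}) ` carrier D \<subseteq> sets L"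
      by blast
  qed
  finally show ?thesis .
qed

lemma AE_pair_fst:
  assumes "sigma_finite_measure L" "AE x in M. P x"
  shows "AE z in M \<Otimes>\<^sub>M L. P (fst z)"
proof -
  interpret sigma_finite_measure L by fact
  obtain Z where Z: "Z \<in> null_sets M" "{x \<in> space M. \<not> P x} \<subseteq> Z"
    using assms(2) unfolding eventually_ae_filter by blast
  have "Z \<times> space L \<in> null_sets (M \<Otimes>\<^sub>M L)"
    using Z(1) by (auto simp: null_sets_def emeasure_pair_measure_Times)
  thus ?thesis
    by (rule AE_I') (use Z(2) in \<open>auto simp: space_pair_measure\<close>)
qed

lemma AE_pair_snd:
  assumes "sigma_finite_measure L" "AE y in L. P y"
  shows "AE z in M \<Otimes>\<^sub>M L. P (snd z)"
proof -
  interpret sigma_finite_measure L by fact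
  obtain Z where Z: "Z \<in> null_sets L" "{x \<in> space L. \<not> P x} \<subseteq> Z"
    using assms(2) unfolding eventually_ae_filter by blast
  have "space M \<times> Z \<in> null_sets (M \<Otimes>\<^sub>M L)"
    using Z(1) by (auto simp: null_sets_def emeasure_pair_measure_Times)
  thus ?thesis
    by (rule AE_I') (use Z(2) in \<open>auto simp: space_pair_measure\<close>)
qed

text \<open>
  Removing from \<open>X\<close> all translates of an exceptional null set turns a property that holds almost
  everywhere into one that holds on all of an invariant conull set.  On such a set, identities
  between translates need no further exceptional sets.
\<close>

lemma invariant_conull_subset:
  assumes "group G" and cG: "countable (carrier G)" and act: "pmp_action G M \<beta>"
    and P: "AE x in M. P x"
  obtains W where "W \<in> sets M" "AE x in M. x \<in> W" "\<And>x. x \<in> W \<Longrightarrow> P x"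
    "\<And>g x. g \<in> carrier G \<Longrightarrow> x \<in> W \<Longrightarrow> \<beta> g x \<in> W"
proof -
  interpret group G by fact
  interpret group_action G "space M" \<beta>
    using act by (simp add: pmp_action_def)
  have meas: "\<beta> g \<in> measurable M M" and pres: "distr M M (\<beta> g) = M" if "g \<in> carrier G" for g
    using act that by (auto simp: pmp_action_def)
  obtain Z where Z: "Z \<in> null_sets M" "{x \<in> space M. \<not> P x} \<subseteq> Z"
    using P unfolding eventually_ae_filter by blast
  define W where "W = {x \<in> space M. \<forall>g\<in>carrier G. \<beta> g x \<notin> Z}"
  show thesis
  proof
    have "W = space M - (\<Union>g\<in>carrier G. \<beta> g -` Z \<inter> space M)"
      by (auto simp: W_def)
    also have "\<dots> \<in> sets M"
      using Z(1) by (intro sets.Diff sets.top sets.countable_UN' cG) (auto intro: measurable_sets[OF meas])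
    finally show "W \<in> sets M" .
    have "AE x in M. \<beta> g x \<notin> Z" if g: "g \<in> carrier G" for g
      by (rule AE_distrD[OF meas[OF g]]) (simp only: pres[OF g] AE_not_in[OF Z(1)])
    hence "AE x in M. \<forall>g\<in>carrier G. \<beta> g x \<notin> Z"
      by (simp add: AE_ball_countable[OF cG])
    thus "AE x in M. x \<in> W"
      using AE_space by eventually_elim (auto simp: W_def)
    show "P x" if "x \<in> W" for x
    proof -
      have "\<beta> \<one>\<^bsub>G\<^esub> x \<notin> Z" "x \<in> space M"
        using that one_closed by (auto simp: W_def)
      thus ?thesis
        using Z(2) group_action_one[OF group_action_axioms] by auto
    qed
    show "\<beta> g x \<in> W" if g: "g \<in> carrier G" and x: "x \<in> W" for g x
    proof -
      have "\<beta> h (\<beta> g x) \<notin> Z" if "h \<in> carrier G" for h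
        using composition_rule[OF _ that g, of x] x m_closed[OF that g] by (auto simp: W_def)
      thus ?thesis
        using x element_image[OF g] by (auto simp: W_def)
    qed
  qed
qed

section \<open>The action on points with an index\<close>

text \<open>
  The assumptions on \<open>W\<close> collect everything that is known almost everywhere of
  the choice functions and of the freeness of \<open>\<alpha>\<close>, on a conull set that is invariant under \<open>G\<close>.
\<close>

locale choice_system =
  fixes G :: "('g, 'm) monoid_scheme" and D :: "('d, 'n) monoid_scheme" and M :: "'x measure"
    and \<alpha> :: "'d \<Rightarrow> 'x \<Rightarrow> 'x" and \<beta> :: "'g \<Rightarrow> 'x \<Rightarrow> 'x" and N :: enat and C :: "nat \<Rightarrow> 'x \<Rightarrow> 'x"
    and W :: "'x set"
  assumes group_G: "group G" and countable_G: "countable (carrier G)"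
    and group_D: "group D" and countable_D: "countable (carrier D)"
    and standard_M: "standard_prob_space M"
    and pmp_\<beta>: "pmp_action G M \<beta>" and pmp_\<alpha>: "pmp_action D M \<alpha>"
    and C_measurable: "n \<in> index_set N \<Longrightarrow> C n \<in> measurable M M"
    and W_sets: "W \<in> sets M" and W_conull: "AE x in M. x \<in> W"
    and W_invariant: "g \<in> carrier G \<Longrightarrow> x \<in> W \<Longrightarrow> \<beta> g x \<in> W"
    and W_inj: "x \<in> W \<Longrightarrow> inj_on (\<lambda>n. C n x) (index_set N)"
    and W_transversal: "x \<in> W \<Longrightarrow> transversal ((\<lambda>n. C n x) ` index_set N)
      (classes_below M (orbit_rel D M \<alpha>) (orbit_rel G M \<beta>) x)"
    and W_free: "x \<in> W \<Longrightarrow> d \<in> carrier D \<Longrightarrow> \<alpha> d x = x \<Longrightarrow> d = \<one>\<^bsub>D\<^esub>"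
begin

abbreviation E :: "'x rel" where "E \<equiv> orbit_rel D M \<alpha>"
abbreviation F :: "'x rel" where "F \<equiv> orbit_rel G M \<beta>"
abbreviation I :: "nat set" where "I \<equiv> index_set N"
abbreviation P :: "'g \<Rightarrow> 'x \<Rightarrow> nat \<Rightarrow> nat" where "P \<equiv> coind_perm E \<beta> N C"

sublocale M: prob_space M
  by (rule standard_prob_space_imp_prob_space[OF standard_M])

sublocale G: group_action G "space M" \<beta>
  using pmp_\<beta> by (simp add: pmp_action_def)

sublocale D: group_action D "space M" \<alpha>
  using pmp_\<alpha> by (simp add: pmp_action_def)

lemma \<beta>_measurable: "g \<in> carrier G \<Longrightarrow> \<beta> g \<in> measurable M M"
  and \<beta>_preserves: "g \<in> carrier G \<Longrightarrow> distr M M (\<beta> g) = M"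
  using pmp_\<beta> by (auto simp: pmp_action_def)

lemma equiv_E: "equiv (space M) E"
  by (rule equiv_orbit_rel[OF D.group_action_axioms])

lemma equiv_F: "equiv (space M) F"
  by (rule equiv_orbit_rel[OF G.group_action_axioms])

lemma W_space: "x \<in> W \<Longrightarrow> x \<in> space M"
  using sets.sets_into_space[OF W_sets] by blast

lemma C_space: "m \<in> I \<Longrightarrow> x \<in> space M \<Longrightarrow> C m x \<in> space M"
  using measurable_space[OF C_measurable] .

lemma class_eq:
  assumes "K \<in> space M // E" "z \<in> K"
  shows "K = E `` {z}"
  using assms equiv_class_eq[OF equiv_E] by (auto elim!: quotientE)

text \<open>
  Together with the invariance of the target under \<open>G\<close>, this makes \<open>\<pi>(\<gamma>, x)\<close> the comparison of two
  enumerations of the same set of classes.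
\<close>

lemma class_bij:
  assumes x: "x \<in> W"
  shows "bij_betw (\<lambda>m. E `` {C m x}) I (classes_below M E F x)"
proof -
  let ?T = "(\<lambda>n. C n x) ` I"
  have T: "?T \<subseteq> \<Union>(classes_below M E F x)"
    and unique: "\<And>K. K \<in> classes_below M E F x \<Longrightarrow> \<exists>!t. t \<in> ?T \<inter> K"
    using W_transversal[OF x] by (auto simp: transversal_def)
  have self: "C m x \<in> E `` {C m x}" if "m \<in> I" for m
    using equiv_class_self[OF equiv_E C_space[OF that W_space[OF x]]] .
  have mem: "E `` {C m x} \<in> classes_below M E F x" if m: "m \<in> I" for m
  proof -
    obtain K where K: "K \<in> classes_below M E F x" "C m x \<in> K"
      using T m by blast
    thus ?thesis
      using class_eq[of K "C m x"] by (simp add: classes_below_def)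
  qed
  show ?thesis
  proof (rule bij_betw_imageI)
    show "inj_on (\<lambda>m. E `` {C m x}) I"
    proof (rule inj_onI)
      fix m n assume mn: "m \<in> I" "n \<in> I" and eq: "E `` {C m x} = E `` {C n x}"
      have "C m x \<in> ?T \<inter> E `` {C m x}" "C n x \<in> ?T \<inter> E `` {C m x}"
        using self[OF mn(1)] self[OF mn(2)] eq mn by auto
      hence "C m x = C n x"
        using unique[OF mem[OF mn(1)]] by blast
      thus "m = n"
        using W_inj[OF x] mn by (auto dest: inj_onD)
    qed
    show "(\<lambda>m. E `` {C m x}) ` I = classes_below M E F x"
    proof (intro equalityI subsetI)
      fix K assume K: "K \<in> classes_below M E F x"
      then obtain m where "m \<in> I" "C m x \<in> K"
        using unique by blast
      thus "K \<in> (\<lambda>m. E `` {C m x}) ` I"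
        using class_eq[of K "C m x"] K by (auto simp: classes_below_def)
    qed (use mem in auto)
  qed
qed

lemma classes_below_shift:
  assumes "x \<in> W" "g \<in> carrier G"
  shows "classes_below M E F (\<beta> g x) = classes_below M E F x"
proof -
  have "(x, \<beta> g x) \<in> F"
    using W_space[OF assms(1)] assms(2) by (auto simp: orbit_rel_def orbit_def)
  thus ?thesis
    using equiv_class_eq[OF equiv_F] by (simp add: classes_below_def)
qed

lemma C_mem_W:
  assumes x: "x \<in> W" and m: "m \<in> I"
  shows "C m x \<in> W"
proof -
  have "C m x \<in> \<Union>(classes_below M E F x)"
    using W_transversal[OF x] m by (auto simp: transversal_def)
  hence "(x, C m x) \<in> F"
    by (auto simp: classes_below_def)
  then obtain g where "g \<in> carrier G" "C m x = \<beta> g x"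
    by (auto simp: orbit_rel_def orbit_def)
  thus ?thesis
    using W_invariant x by simp
qed

lemma coind_perm_eqI:
  assumes x: "x \<in> W" and g: "g \<in> carrier G" and n: "n \<in> I"
    and eq: "E `` {C m x} = E `` {C n (\<beta> g x)}"
  shows "P g x m = n"
  unfolding coind_perm_def
proof (rule the_equality)
  fix n' assume "n' \<in> I \<and> E `` {C m x} = E `` {C n' (\<beta> g x)}"
  thus "n' = n"
    using bij_betw_imp_inj_on[OF class_bij[OF W_invariant[OF g x]]] n eq by (auto dest: inj_onD)
qed (use n eq in simp)

lemma coind_perm_class:
  assumes x: "x \<in> W" and g: "g \<in> carrier G" and m: "m \<in> I"
  shows "P g x m \<in> I" and "E `` {C m x} = E `` {C (P g x m) (\<beta> g x)}"
proof -
  have "E `` {C m x} \<in> classes_below M E F (\<beta> g x)"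
    using bij_betwE[OF class_bij[OF x]] m by (simp add: classes_below_shift[OF x g])
  hence "E `` {C m x} \<in> (\<lambda>n. E `` {C n (\<beta> g x)}) ` I"
    unfolding bij_betw_imp_surj_on[OF class_bij[OF W_invariant[OF g x]]] .
  then obtain n where n: "n \<in> I" "E `` {C m x} = E `` {C n (\<beta> g x)}"
    by (elim imageE)
  have "P g x m = n"
    by (rule coind_perm_eqI[OF x g n])
  thus "P g x m \<in> I" "E `` {C m x} = E `` {C (P g x m) (\<beta> g x)}"
    using n by auto
qed

lemma coind_perm_bij:
  assumes x: "x \<in> W" and g: "g \<in> carrier G"
  shows "bij_betw (P g x) I I"
proof (rule bij_betw_imageI)
  show "inj_on (P g x) I"
  proof (rule inj_onI)
    fix m n assume mn: "m \<in> I" "n \<in> I" and "P g x m = P g x n"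
    hence "E `` {C m x} = E `` {C n x}"
      using coind_perm_class(2)[OF x g mn(1)] coind_perm_class(2)[OF x g mn(2)] by simp
    thus "m = n"
      using inj_onD[OF bij_betw_imp_inj_on[OF class_bij[OF x]]] mn by simp
  qed
  have "n \<in> P g x ` I" if n: "n \<in> I" for n
  proof -
    have "E `` {C n (\<beta> g x)} \<in> classes_below M E F x"
      using bij_betwE[OF class_bij[OF W_invariant[OF g x]]] n by (simp add: classes_below_shift[OF x g])
    hence "E `` {C n (\<beta> g x)} \<in> (\<lambda>m. E `` {C m x}) ` I"
      unfolding bij_betw_imp_surj_on[OF class_bij[OF x]] .
    then obtain m where "m \<in> I" "E `` {C m x} = E `` {C n (\<beta> g x)}"
      by (elim imageE) simp
    thus ?thesis
      using coind_perm_eqI[OF x g n] by blast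
  qed
  thus "P g x ` I = I"
    using coind_perm_class(1)[OF x g] by blast
qed

lemma coind_perm_eq_iff:
  assumes x: "x \<in> W" and g: "g \<in> carrier G" and m: "m \<in> I" and n: "n \<in> I"
  shows "P g x m = n \<longleftrightarrow> (C m x, C n (\<beta> g x)) \<in> E"
proof -
  have "P g x m = n \<longleftrightarrow> E `` {C m x} = E `` {C n (\<beta> g x)}"
    using coind_perm_eqI[OF x g n] coind_perm_class(2)[OF x g m] by blast
  also have "\<dots> \<longleftrightarrow> (C m x, C n (\<beta> g x)) \<in> E"
    using C_space m n W_space x W_invariant[OF g x] by (intro eq_equiv_class_iff[OF equiv_E]) auto
  finally show ?thesis .
qed

lemma coind_perm_inv:
  assumes x: "x \<in> W" and g: "g \<in> carrier G" and m: "m \<in> I"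
  shows "coind_perm_inv E \<beta> N C g x (P g x m) = m"
  unfolding coind_perm_inv_def
  by (rule inv_into_f_f[OF bij_betw_imp_inj_on[OF coind_perm_bij[OF x g]] m])

text \<open>
  An element of \<open>D\<close> that carries \<open>C\<^sub>m(x)\<close> to the representative of its class chosen at \<open>\<gamma> x\<close> is unique
  because \<open>C\<^sub>m(x)\<close>, which lies in the \<open>F\<close>-class of \<open>x\<close>, is again a point of \<open>W\<close>, where the action is free.
\<close>

lemma coind_delta_closed:
  assumes x: "x \<in> W" and g: "g \<in> carrier G" and m: "m \<in> I"
  shows "coind_delta D M \<alpha> \<beta> N C g x (P g x m) \<in> carrier D"
proof -
  let ?z = "C m x" and ?z' = "C (P g x m) (\<beta> g x)"
  interpret Dg: group D by (rule group_D)
  have z: "?z \<in> W" "?z \<in> space M"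
    using C_mem_W[OF x m] W_space by auto
  have "(?z, ?z') \<in> E"
    using coind_perm_eq_iff[OF x g m coind_perm_class(1)[OF x g m]] by simp
  then obtain d where d: "d \<in> carrier D" "\<alpha> d ?z = ?z'"
    by (auto simp: orbit_rel_def orbit_def)
  have "d' = d" if d': "d' \<in> carrier D" "\<alpha> d' ?z = ?z'" for d'
  proof -
    have "\<alpha> (inv\<^bsub>D\<^esub> d \<otimes>\<^bsub>D\<^esub> d') ?z = \<alpha> (inv\<^bsub>D\<^esub> d) (\<alpha> d' ?z)"
      using z d d' by (intro D.composition_rule) auto
    also have "\<dots> = ?z"
      using group_action_inv_cancel[OF D.group_action_axioms d(1) z(2)] d d' by simp
    finally have "inv\<^bsub>D\<^esub> d \<otimes>\<^bsub>D\<^esub> d' = \<one>\<^bsub>D\<^esub>"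
      using W_free[OF z(1)] d d' by simp
    thus ?thesis
      using d d' by (metis Dg.inv_closed Dg.inv_equality Dg.inv_inv)
  qed
  hence "\<exists>!d. d \<in> carrier D \<and> \<alpha> d ?z = ?z'"
    using d by blast
  thus ?thesis
    unfolding coind_delta_def coind_perm_inv[OF x g m] by (rule theI'[THEN conjunct1])
qed

definition Z :: "('x \<times> nat) measure" where
  "Z = M \<Otimes>\<^sub>M count_space I"

text \<open>
  Off \<open>W\<close> the description of \<open>\<pi>\<close> by a definite article has no content, so it is replaced by the
  identity.  Then the maps \<open>S g\<close> below are measurable, and they are an action at every point.
\<close>

definition perm :: "'g \<Rightarrow> 'x \<Rightarrow> nat \<Rightarrow> nat" where
  "perm g x m = (if x \<in> W then P g x m else m)"

definition S :: "'g \<Rightarrow> 'x \<times> nat \<Rightarrow> 'x \<times> nat" where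
  "S g z = (\<beta> g (fst z), perm g (fst z) (snd z))"

sublocale I: sigma_finite_measure "count_space I"
  by (rule sigma_finite_measure_count_space_countable) simp

sublocale MI: pair_sigma_finite M "count_space I" ..

lemma space_Z: "space Z = space M \<times> I"
  by (simp add: Z_def space_pair_measure)

lemma perm_bij: "g \<in> carrier G \<Longrightarrow> bij_betw (perm g x) I I"
  using bij_betw_id by (cases "x \<in> W") (simp_all add: perm_def[abs_def] coind_perm_bij id_def)

lemma matching_set_measurable:
  assumes "g \<in> carrier G" "m \<in> I" "n \<in> I"
  shows "{x \<in> space M. (C m x, C n (\<beta> g x)) \<in> E} \<in> sets M"
  by (rule measurable_orbit_rel[OF standard_M pmp_\<alpha> countable_D C_measurable[OF assms(2)]
        measurable_compose[OF \<beta>_measurable[OF assms(1)] C_measurable[OF assms(3)]]])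

lemma S_measurable:
  assumes g: "g \<in> carrier G"
  shows "S g \<in> measurable Z Z"
proof -
  note [measurable] = \<beta>_measurable[OF g]
  have "(\<lambda>x. perm g x m) \<in> measurable M (count_space I)" if m: "m \<in> I" for m
    unfolding measurable_count_space_eq2_countable
  proof (intro conjI ballI)
    show "(\<lambda>x. perm g x m) \<in> space M \<rightarrow> I"
      using bij_betwE[OF perm_bij[OF g]] m by blast
    fix n assume n: "n \<in> I"
    have "(\<lambda>x. perm g x m) -` {n} \<inter> space M =
       W \<inter> {x \<in> space M. (C m x, C n (\<beta> g x)) \<in> E} \<union> (if m = n then space M - W else {})"
    proof (rule Set.set_eqI)
      fix x
      show "x \<in> (\<lambda>x. perm g x m) -` {n} \<inter> space M \<longleftrightarrow>
        x \<in> W \<inter> {x \<in> space M. (C m x, C n (\<beta> g x)) \<in> E} \<union> (if m = n then space M - W else {})"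
        using coind_perm_eq_iff[OF _ g m n, of x] by (cases "x \<in> W") (auto simp: perm_def)
    qed
    thus "(\<lambda>x. perm g x m) -` {n} \<inter> space M \<in> sets M"
      using W_sets matching_set_measurable[OF g m n] by auto
  qed
  hence "(\<lambda>z. perm g (fst z) (snd z)) \<in> measurable Z (count_space I)"
    unfolding Z_def
    by (intro measurable_compose_countable'[where f = "\<lambda>m z. perm g (fst z) m" and g = snd and I = I])
       (auto intro: measurable_compose[OF measurable_fst])
  moreover have "(\<lambda>z. \<beta> g (fst z)) \<in> measurable Z M"
    unfolding Z_def by measurable
  ultimately have "(\<lambda>z. (\<beta> g (fst z), perm g (fst z) (snd z))) \<in> measurable Z (M \<Otimes>\<^sub>M count_space I)"
    by (rule measurable_Pair[rotated])
  thus ?thesis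
    by (simp add: S_def[abs_def] Z_def)
qed

text \<open>
  On each fibre \<open>S g\<close> is a bijection, which preserves counting measure, and on the base it is the
  measure preserving map \<open>\<beta> g\<close>.
\<close>

lemma S_preserves:
  assumes g: "g \<in> carrier G"
  shows "distr Z Z (S g) = Z"
proof (rule measure_eqI)
  fix A assume "A \<in> sets (distr Z Z (S g))"
  hence A[measurable]: "A \<in> sets (M \<Otimes>\<^sub>M count_space I)" and A': "A \<in> sets Z"
    by (auto simp: Z_def)
  note [measurable] = S_measurable[OF g] \<beta>_measurable[OF g]
  have "emeasure (distr Z Z (S g)) A = (\<integral>\<^sup>+z. indicator A (S g z) \<partial>Z)"
    using nn_integral_distr[OF S_measurable[OF g], of "indicator A"] A' by simp
  also have "\<dots> = (\<integral>\<^sup>+x. (\<integral>\<^sup>+m. indicator A (S g (x, m)) \<partial>count_space I) \<partial>M)"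
    unfolding Z_def
    by (rule I.nn_integral_fst[symmetric])
       (use S_measurable[OF g] A' in \<open>simp add: Z_def[symmetric]\<close>)
  also have "\<dots> = (\<integral>\<^sup>+x. (\<integral>\<^sup>+m. indicator A (\<beta> g x, m) \<partial>count_space I) \<partial>M)"
    by (simp add: S_def nn_integral_bij_count_space[OF perm_bij[OF g], of "\<lambda>m. indicator A (\<beta> g _, m)"])
  also have "\<dots> = (\<integral>\<^sup>+x. (\<integral>\<^sup>+m. indicator A (x, m) \<partial>count_space I) \<partial>distr M M (\<beta> g))"
    by (rule nn_integral_distr[symmetric]) measurable
  also have "\<dots> = emeasure Z A"
    unfolding \<beta>_preserves[OF g] Z_def by (simp add: I.nn_integral_fst)
  finally show "emeasure (distr Z Z (S g)) A = emeasure Z A" .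
qed simp

lemma S_comp:
  assumes g: "g \<in> carrier G" and h: "h \<in> carrier G" and z: "z \<in> space Z"
  shows "S g (S h z) = S (g \<otimes>\<^bsub>G\<^esub> h) z"
proof -
  interpret Gg: group G by (rule group_G)
  obtain x m where z_eq: "z = (x, m)" and x: "x \<in> space M" and m: "m \<in> I"
    using z by (auto simp: space_Z)
  have \<beta>: "\<beta> (g \<otimes>\<^bsub>G\<^esub> h) x = \<beta> g (\<beta> h x)"
    by (rule G.composition_rule[OF x g h])
  have "perm g (\<beta> h x) (perm h x m) = perm (g \<otimes>\<^bsub>G\<^esub> h) x m"
  proof (cases "x \<in> W")
    case True
    note hx = W_invariant[OF h True] and p = coind_perm_class[OF True h m]
    note q = coind_perm_class[OF hx g p(1)]
    have "P (g \<otimes>\<^bsub>G\<^esub> h) x m = P g (\<beta> h x) (P h x m)"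
      using coind_perm_eqI[OF True _ q(1), of "g \<otimes>\<^bsub>G\<^esub> h" m] p q g h \<beta> by simp
    thus ?thesis
      using True hx by (simp add: perm_def)
  next
    case False
    have "\<beta> h x \<notin> W"
      using W_invariant[of "inv\<^bsub>G\<^esub> h" "\<beta> h x"] False h
        group_action_inv_cancel[OF G.group_action_axioms h x] by auto
    thus ?thesis
      using False by (simp add: perm_def)
  qed
  thus ?thesis
    by (simp add: S_def z_eq \<beta>)
qed

lemma S_one:
  assumes z: "z \<in> space Z"
  shows "S \<one>\<^bsub>G\<^esub> z = z"
proof -
  interpret Gg: group G by (rule group_G)
  obtain x m where z_eq: "z = (x, m)" and x: "x \<in> space M" and m: "m \<in> I"
    using z by (auto simp: space_Z)
  have \<beta>: "\<beta> \<one>\<^bsub>G\<^esub> x = x"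
    by (rule group_action_one[OF G.group_action_axioms x])
  have "perm \<one>\<^bsub>G\<^esub> x m = m"
    using coind_perm_eqI[of x "\<one>\<^bsub>G\<^esub>" m m] m by (simp add: perm_def \<beta>)
  thus ?thesis
    by (simp add: S_def z_eq \<beta>)
qed

end

section \<open>An invariant weight\<close>

context choice_system
begin

text \<open>
  The coefficient \<open>\<phi>\<^sup>k\<^sup>,\<^sup>n\<close> is a matrix coefficient of the action of \<open>G\<close> on the functions on \<open>X \<times> I\<close>.
\<close>

lemma integral_fibre_eq_phi_coeff:
  assumes g: "g \<in> carrier G" and k: "k \<in> I" and n: "n \<in> I"
  shows "(\<integral>x. indicator (space M \<times> {n}) (S g (x, k)) \<partial>M) = phi_coeff M E \<beta> C k n g"
proof -
  note sets = matching_set_measurable[OF g k n]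
  have "(\<integral>x. indicator (space M \<times> {n}) (S g (x, k)) \<partial>M)
      = (\<integral>x. indicat_real {x \<in> space M. (C k x, C n (\<beta> g x)) \<in> E} x \<partial>M)"
  proof (rule integral_cong_AE)
    show "(\<lambda>x. indicat_real (space M \<times> {n}) (S g (x, k))) \<in> borel_measurable M"
    proof (rule measurable_compose[where N = Z])
      show "(\<lambda>x. S g (x, k)) \<in> measurable M Z"
        using k by (intro measurable_compose[OF _ S_measurable[OF g]]) (simp add: Z_def)
      show "indicat_real (space M \<times> {n}) \<in> borel_measurable Z"
        using n by (simp add: Z_def)
    qed
    show "AE x in M. indicat_real (space M \<times> {n}) (S g (x, k))
        = indicat_real {x \<in> space M. (C k x, C n (\<beta> g x)) \<in> E} x"
      using W_conull
    proof eventually_elim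
      case (elim x)
      thus ?case
        using coind_perm_eq_iff[OF elim g k n] W_space W_invariant[OF g elim]
        by (auto simp: S_def perm_def indicator_def)
    qed
  qed (use sets in simp)
  also have "\<dots> = phi_coeff M E \<beta> C k n g"
    by (simp add: phi_coeff_def Int_def conj_commute cong: conj_cong)
  finally show ?thesis .
qed

text \<open>
  The minimal norm argument is applied to the set of all functions into \<open>[0, 1]\<close> of integral at
  most \<open>1\<close> each of whose translates has integral at least \<open>\<epsilon>\<close> over the layer \<open>X \<times> {k}\<close>.  It is convex
  and closed under translation, and by the lower bound on \<open>\<phi>\<^sup>k\<^sup>,\<^sup>n\<close> it contains the indicator of the
  layer \<open>X \<times> {n}\<close>.  The upper bound \<open>1\<close> makes dominated convergence on a single layer available,
  and the bound on the integral gives the limit a finite integral by Fatou's lemma.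
\<close>

lemma invariant_weight:
  assumes k: "k \<in> I" and n: "n \<in> I" and \<epsilon>: "\<And>g. g \<in> carrier G \<Longrightarrow> \<epsilon> \<le> phi_coeff M E \<beta> C k n g"
  obtains h :: "'x \<times> nat \<Rightarrow> real" where "h \<in> borel_measurable Z" "integrable Z h"
    "\<And>g. g \<in> carrier G \<Longrightarrow> AE z in Z. h (S g z) = h z"
    "\<epsilon> \<le> (\<integral>x. h (x, k) \<partial>M)"
proof -
  interpret Gg: group G by (rule group_G)
  define K where "K = {f \<in> borel_measurable Z. (\<forall>z. 0 \<le> f z \<and> f z \<le> (1::real)) \<and> integrable Z f \<and>
    (\<integral>z. f z \<partial>Z) \<le> 1 \<and> (\<forall>g\<in>carrier G. \<epsilon> \<le> (\<integral>x. f (S g (x, k)) \<partial>M))}"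
  have fib: "(\<lambda>x. S g (x, k)) \<in> measurable M Z" if "g \<in> carrier G" for g
    using k by (intro measurable_compose[OF _ S_measurable[OF that]]) (simp add: Z_def)
  have fib_space: "(x, k) \<in> space Z" if "x \<in> space M" for x
    using that k by (simp add: space_Z)
  have K_bounds: "0 \<le> f z" "f z \<le> 1" if "f \<in> K" for f z
    using that unfolding K_def by blast+
  have fib_int: "integrable M (\<lambda>x. f (S g (x, k)))" if f: "f \<in> K" and g: "g \<in> carrier G" for f g
  proof (rule M.integrable_const_bound[of _ 1])
    show "AE x in M. norm (f (S g (x, k))) \<le> 1"
      using K_bounds[OF f] by simp
    show "(\<lambda>x. f (S g (x, k))) \<in> borel_measurable M"
      using f measurable_compose[OF fib[OF g], of f borel] by (simp add: K_def)
  qed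
  have "emeasure Z (space M \<times> {n}) = 1"
    using n by (simp add: Z_def I.emeasure_pair_measure_Times M.emeasure_space_1)
  hence start: "indicator (space M \<times> {n}) \<in> K"
    using n \<epsilon> integral_fibre_eq_phi_coeff[OF _ k n]
    by (auto simp: K_def Z_def measure_def indicator_def)
  have midpoint: "(\<lambda>z. (f z + f' z) / 2) \<in> K" if f: "f \<in> K" "f' \<in> K" for f f'
  proof -
    have "\<epsilon> \<le> (\<integral>x. (f (S g (x, k)) + f' (S g (x, k))) / 2 \<partial>M)" if g: "g \<in> carrier G" for g
    proof -
      have "\<epsilon> \<le> (\<integral>x. f (S g (x, k)) \<partial>M)" "\<epsilon> \<le> (\<integral>x. f' (S g (x, k)) \<partial>M)"
        using f g by (auto simp: K_def)
      thus ?thesis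
        using fib_int[OF f(1) g] fib_int[OF f(2) g] by simp
    qed
    moreover have "0 \<le> (f z + f' z) / 2 \<and> (f z + f' z) / 2 \<le> 1" for z
      using K_bounds[OF f(1), of z] K_bounds[OF f(2), of z] by simp
    moreover have "f \<in> borel_measurable Z" "integrable Z f" "integral\<^sup>L Z f \<le> 1"
      "f' \<in> borel_measurable Z" "integrable Z f'" "integral\<^sup>L Z f' \<le> 1"
      using f unfolding K_def by blast+
    ultimately show ?thesis
      unfolding K_def by (intro CollectI conjI ballI allI) auto
  qed
  have closed: "(\<lambda>z. f (S g z)) \<in> K" if f: "f \<in> K" and g: "g \<in> carrier G" for f g
  proof -
    note meas = S_measurable[OF g] and pres = S_preserves[OF g]
    have fm: "f \<in> borel_measurable Z" and fi: "integrable Z f"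
      using f by (auto simp: K_def)
    have "(\<lambda>z. f (S g z)) \<in> borel_measurable Z"
      by (rule measurable_compose[OF meas fm])
    moreover have "integrable Z (\<lambda>z. f (S g z))"
      by (rule integrable_distr[OF meas]) (simp only: pres fi)
    moreover have "(\<integral>z. f (S g z) \<partial>Z) = (\<integral>z. f z \<partial>Z)"
      using integral_distr[OF meas fm] by (simp only: pres)
    moreover have "\<epsilon> \<le> (\<integral>x. f (S g (S h (x, k))) \<partial>M)" if h: "h \<in> carrier G" for h
    proof -
      have "(\<integral>x. f (S g (S h (x, k))) \<partial>M) = (\<integral>x. f (S (g \<otimes>\<^bsub>G\<^esub> h) (x, k)) \<partial>M)"
        by (intro Bochner_Integration.integral_cong) (simp_all add: S_comp[OF g h fib_space])
      thus ?thesis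
        using f g h by (simp add: K_def)
    qed
    ultimately show ?thesis
      using K_bounds[OF f] f unfolding K_def by simp
  qed
  obtain u h where u: "\<And>j::nat. u j \<in> K" and h: "h \<in> borel_measurable Z"
    and h01: "\<And>z. 0 \<le> h z \<and> h z \<le> 1"
    and lim: "AE z in Z. (\<lambda>j. u j z) \<longlonglongrightarrow> h z"
    and inv: "\<And>S. \<lbrakk>S \<in> measurable Z Z; distr Z Z S = Z; \<And>g. g \<in> K \<Longrightarrow> (\<lambda>z. g (S z)) \<in> K\<rbrakk>
          \<Longrightarrow> AE z in Z. h (S z) = h z"
  proof (rule convex_min_norm_limit[of K Z])
    show "K \<noteq> {}"
      using start by blast
  qed (use midpoint in \<open>auto simp: K_def\<close>)
  have um: "u j \<in> borel_measurable Z" for j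
    using u by (auto simp: K_def)
  note u01 = K_bounds[OF u]
  show thesis
  proof (rule that[OF h])
    have "(\<integral>\<^sup>+z. ennreal (h z) \<partial>Z) = (\<integral>\<^sup>+z. liminf (\<lambda>j. ennreal (u j z)) \<partial>Z)"
    proof (rule nn_integral_cong_AE)
      show "AE z in Z. ennreal (h z) = liminf (\<lambda>j. ennreal (u j z))"
        using lim
      proof eventually_elim
        case (elim z)
        show ?case
          using lim_imp_Liminf[OF sequentially_bot tendsto_ennrealI[OF elim]] by simp
      qed
    qed
    also have "\<dots> \<le> liminf (\<lambda>j. \<integral>\<^sup>+z. ennreal (u j z) \<partial>Z)"
      using um by (intro nn_integral_liminf) measurable
    also have "\<dots> \<le> liminf (\<lambda>j. 1 :: ennreal)"
    proof (intro Liminf_mono always_eventually allI)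
      fix j
      have "(\<integral>\<^sup>+z. ennreal (u j z) \<partial>Z) = ennreal (\<integral>z. u j z \<partial>Z)"
        using u[of j] by (intro nn_integral_eq_integral) (auto simp: K_def)
      also have "\<dots> \<le> 1"
        using u[of j] by (simp add: K_def)
      finally show "(\<integral>\<^sup>+z. ennreal (u j z) \<partial>Z) \<le> 1" .
    qed
    also have "\<dots> < \<infinity>"
      by (simp add: Liminf_const)
    finally show "integrable Z h"
      using h h01 by (intro integrableI_nonneg) auto
    show "AE z in Z. h (S g z) = h z" if "g \<in> carrier G" for g
      using that by (intro inv S_measurable S_preserves closed)
    have "(\<lambda>j. \<integral>x. u j (x, k) \<partial>M) \<longlonglongrightarrow> (\<integral>x. h (x, k) \<partial>M)"
    proof (rule integral_dominated_convergence[where w = "\<lambda>_. 1"])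
      have [measurable]: "(\<lambda>x. (x, k)) \<in> measurable M Z"
        using k by (simp add: Z_def)
      show "(\<lambda>x. h (x, k)) \<in> borel_measurable M"
        using h by measurable
      show "(\<lambda>x. u j (x, k)) \<in> borel_measurable M" for j
        using um by measurable
      have "AE x in M. AE m in count_space I. (\<lambda>j. u j (x, m)) \<longlonglongrightarrow> h (x, m)"
        using lim unfolding Z_def by (rule MI.AE_pair)
      thus "AE x in M. (\<lambda>j. u j (x, k)) \<longlonglongrightarrow> h (x, k)"
        by eventually_elim (use k in \<open>simp add: AE_count_space\<close>)
    qed (use u01 in auto)
    moreover have "\<epsilon> \<le> (\<integral>x. u j (x, k) \<partial>M)" for j
    proof -
      have "\<epsilon> \<le> (\<integral>x. u j (S \<one>\<^bsub>G\<^esub> (x, k)) \<partial>M)"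
        using u[of j] by (auto simp: K_def)
      also have "\<dots> = (\<integral>x. u j (x, k) \<partial>M)"
        by (intro Bochner_Integration.integral_cong) (simp_all add: S_one fib_space)
      finally show ?thesis .
    qed
    ultimately show "\<epsilon> \<le> (\<integral>x. h (x, k) \<partial>M)"
      by (intro LIMSEQ_le_const) auto
  qed
qed

end

section \<open>Weighted sums of independent coordinates\<close>

text \<open>
  The centred indicators of the events \<open>y\<^sub>m \<in> A\<close> are orthogonal, since distinct coordinates are
  independent.
\<close>

lemma coordinate_correlation:
  assumes "prob_space Q" and A: "A \<in> sets Q" and m: "m \<in> I" and k: "k \<in> I"
  defines "f \<equiv> \<lambda>y. indicator A y - measure Q A"
  shows "(\<integral>y. f (y m) \<partial>(\<Pi>\<^sub>M n\<in>I. Q)) = 0"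
    and "(\<integral>y. f (y m) * f (y k) \<partial>(\<Pi>\<^sub>M n\<in>I. Q))
      = (if m = k then measure Q A * (1 - measure Q A) else (0::real))"
proof -
  interpret Q: prob_space Q by fact
  interpret P: product_prob_space "\<lambda>_. Q" I
    by unfold_locales
  let ?P = "\<Pi>\<^sub>M n\<in>I. Q"
  define p where "p = measure Q A"
  have meas_coord[measurable]: "(\<lambda>y. indicator A (y i) :: real) \<in> borel_measurable ?P" if "i \<in> I" for i
    using that A by measurable
  note [measurable] = A m k
  have single: "measure ?P {y \<in> space ?P. y i \<in> A} = p" if "i \<in> I" for i
    using P.emeasure_PiM_Collect_single[OF that A]
    by (simp add: P.emeasure_eq_measure Q.emeasure_eq_measure p_def)
  have ind: "(\<integral>y. indicator A (y i) \<partial>?P) = p" if i: "i \<in> I" for i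
  proof -
    have "(\<integral>y. indicator A (y i) \<partial>?P) = (\<integral>y. indicat_real {y \<in> space ?P. y i \<in> A} y \<partial>?P)"
      by (intro Bochner_Integration.integral_cong) (auto simp: indicator_def)
    thus ?thesis
      using single[OF i] by (simp add: Int_absorb2)
  qed
  have ind2: "(\<integral>y. indicator A (y m) * indicator A (y k) \<partial>?P) = (if m = k then p else p * p)"
  proof (cases "m = k")
    case True
    have "(\<integral>y. indicator A (y k) * indicator A (y k) \<partial>?P) = (\<integral>y. indicat_real A (y k) \<partial>?P)"
      by (simp only: indicator_inter_arith[symmetric] Int_absorb)
    thus ?thesis
      using ind[OF k] unfolding True by simp
  next
    case False
    have "(\<integral>y. indicator A (y m) * indicator A (y k) \<partial>?P)
        = (\<integral>y. indicat_real {y \<in> space ?P. \<forall>i\<in>{m,k}. y i \<in> A} y \<partial>?P)"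
      by (intro Bochner_Integration.integral_cong refl) (simp add: indicator_def)
    also have "\<dots> = p * p"
      using P.emeasure_PiM_Collect[of "{m,k}" "\<lambda>_. A"] m k A False
      by (simp add: P.emeasure_eq_measure Q.emeasure_eq_measure p_def flip: ennreal_mult)
    finally show ?thesis
      using False by simp
  qed
  have intg: "integrable ?P (\<lambda>y. indicator A (y i) :: real)" if i: "i \<in> I" for i
    using i by (intro P.integrable_const_bound[of _ 1]) auto
  have intg2: "integrable ?P (\<lambda>y. indicator A (y m) * indicator A (y k) :: real)"
    by (intro P.integrable_const_bound[of _ 1]) (auto simp: indicator_def)
  show "(\<integral>y. f (y m) \<partial>?P) = 0"
    using ind[OF m] intg[OF m] by (simp add: f_def P.P.prob_space p_def)
  have "(\<integral>y. f (y m) * f (y k) \<partial>?P)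
      = (\<integral>y. indicator A (y m) * indicator A (y k) - p * indicator A (y m) - p * indicator A (y k) + p * p \<partial>?P)"
    by (intro Bochner_Integration.integral_cong) (auto simp: f_def p_def algebra_simps)
  also have "\<dots> = (if m = k then p * (1 - p) else 0)"
    using ind2 ind[OF m] ind[OF k] intg[OF m] intg[OF k] intg2
    by (simp add: P.P.prob_space algebra_simps)
  finally show "(\<integral>y. f (y m) * f (y k) \<partial>?P) = (if m = k then measure Q A * (1 - measure Q A) else 0)"
    by (simp add: p_def)
qed

text \<open>
  Pairing the series with \<open>f(y\<^sub>k)\<close> recovers the weight \<open>w\<^sub>k\<close>, by orthogonality.  The series is an
  integral over counting measure, so it may be integrated term by term by Fubini.
\<close>

lemma weighted_coordinate_sum:
  fixes w :: "nat \<Rightarrow> real" and I :: "nat set"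
  assumes Q: "prob_space Q" and A: "A \<in> sets Q" and w: "integrable (count_space I) w" and k: "k \<in> I"
  defines "f \<equiv> \<lambda>y. indicator A y - measure Q A"
    and "\<phi> \<equiv> \<lambda>y. \<integral>m. w m * (indicator A (y m) - measure Q A) \<partial>count_space I"
  shows "integrable (\<Pi>\<^sub>M n\<in>I. Q) \<phi>"
    and "(\<integral>y. \<phi> y \<partial>(\<Pi>\<^sub>M n\<in>I. Q)) = 0"
    and "(\<integral>y. \<phi> y * f (y k) \<partial>(\<Pi>\<^sub>M n\<in>I. Q)) = w k * (measure Q A * (1 - measure Q A))"
proof -
  interpret Q: prob_space Q by fact
  interpret PQ: product_prob_space "\<lambda>_. Q" I
    by unfold_locales
  let ?P = "\<Pi>\<^sub>M n\<in>I. Q"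
  interpret C: sigma_finite_measure "count_space I"
    by (rule sigma_finite_measure_count_space_countable) simp
  interpret PC: pair_sigma_finite ?P "count_space I" ..
  have f_def': "f = (\<lambda>y. indicator A y - measure Q A)"
    by (simp add: f_def)
  have [measurable]: "f \<in> borel_measurable Q"
    using A by (simp add: f_def')
  have coord[measurable]: "(\<lambda>y. f (y m)) \<in> borel_measurable ?P" if "m \<in> I" for m
    using that by measurable
  have f1: "\<bar>f y\<bar> \<le> 1" for y
    using Q.prob_le_1[of A] by (auto simp: f_def' indicator_def)
  let ?PI = "?P \<Otimes>\<^sub>M count_space I"
  have wm: "(\<lambda>z. w (snd z)) \<in> borel_measurable ?PI"
    by (rule measurable_compose[OF measurable_snd]) simp
  have fm: "(\<lambda>z. f (fst z (snd z))) \<in> borel_measurable ?PI"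
    by (rule measurable_compose_countable'[where f = "\<lambda>m z. f (fst z m)" and g = snd and I = I])
       (auto intro: measurable_compose[OF measurable_fst coord])
  have fk: "(\<lambda>z. f (fst z k)) \<in> borel_measurable ?PI"
    by (rule measurable_compose[OF measurable_fst coord[OF k]])
  have int_w: "integrable ?PI (\<lambda>z. w (snd z))"
    by (rule PC.Fubini_integrable[OF wm]) (use w in auto)
  have int1: "integrable ?PI (\<lambda>z. w (snd z) * f (fst z (snd z)))"
    by (rule Bochner_Integration.integrable_bound[OF int_w borel_measurable_times[OF wm fm]])
       (simp add: abs_mult mult_left_le[OF f1])
  have int2: "integrable ?PI (\<lambda>z. w (snd z) * f (fst z (snd z)) * f (fst z k))"
    by (rule Bochner_Integration.integrable_bound[OF int1
          borel_measurable_times[OF borel_measurable_times[OF wm fm] fk]])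
       (simp add: abs_mult mult_left_le[OF f1])
  have \<phi>: "\<phi> = (\<lambda>y. \<integral>m. w m * f (y m) \<partial>count_space I)"
    by (simp add: \<phi>_def f_def')
  note corr = coordinate_correlation[OF Q A _ k, folded f_def']
  show "integrable ?P \<phi>"
    unfolding \<phi> using PC.integrable_fst[of "\<lambda>y m. w m * f (y m)"] int1 by (simp add: split_beta')
  have "(\<integral>y. \<phi> y \<partial>?P) = (\<integral>m. \<integral>y. w m * f (y m) \<partial>?P \<partial>count_space I)"
    unfolding \<phi> using PC.Fubini_integral[of "\<lambda>y m. w m * f (y m)"] int1 by (simp add: split_beta')
  also have "\<dots> = (\<integral>m. 0 \<partial>count_space I)"
    using corr(1) by (intro Bochner_Integration.integral_cong) (auto simp: f_def')
  finally show "(\<integral>y. \<phi> y \<partial>?P) = 0"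
    by simp
  have "(\<integral>y. \<phi> y * f (y k) \<partial>?P) = (\<integral>y. \<integral>m. w m * f (y m) * f (y k) \<partial>count_space I \<partial>?P)"
    by (simp add: \<phi>)
  also have "\<dots> = (\<integral>m. \<integral>y. w m * f (y m) * f (y k) \<partial>?P \<partial>count_space I)"
    using PC.Fubini_integral[of "\<lambda>y m. w m * f (y m) * f (y k)"] int2 by (simp add: split_beta')
  also have "\<dots> = (\<integral>m. w k * (measure Q A * (1 - measure Q A)) * indicator {k} m \<partial>count_space I)"
    using corr(2) by (intro Bochner_Integration.integral_cong) (auto simp: f_def' mult.assoc)
  also have "\<dots> = w k * (measure Q A * (1 - measure Q A))"
    using k by (simp add: measure_count_space)
  finally show "(\<integral>y. \<phi> y * f (y k) \<partial>?P) = w k * (measure Q A * (1 - measure Q A))" .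
qed

section \<open>Ergodicity of the co-induced action\<close>

context choice_system
begin

text \<open>
  The invariant set tested against ergodicity is \<open>{\<Phi> > 0}\<close>.  One set is enough because \<open>\<Phi>(x, \<cdot>)\<close> has
  mean zero for almost every \<open>x\<close>: a function of constant sign and mean zero vanishes.
\<close>

lemma coinduced_ergodic_imp_ergodic:
  fixes Q :: "'y measure" and a :: "'d \<Rightarrow> 'y \<Rightarrow> 'y"
  assumes k: "k \<in> I" and n: "n \<in> I" and \<epsilon>: "0 < \<epsilon>"
    and phi: "\<And>g. g \<in> carrier G \<Longrightarrow> \<epsilon> \<le> phi_coeff M E \<beta> C k n g"
    and Q: "prob_space Q" and a: "pmp_action D Q a"
    and erg: "ergodic G (coind_space M Q N) (coind_action D M \<alpha> \<beta> N C a)"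
  shows "ergodic D Q a"
  unfolding ergodic_def
proof (intro ballI impI)
  fix A assume A[measurable]: "A \<in> sets Q" and inv_A: "\<forall>d\<in>carrier D. AE y in Q. (a d y \<in> A) = (y \<in> A)"
  interpret Q: prob_space Q by (rule Q)
  interpret PQ: product_prob_space "\<lambda>_. Q" I
    by unfold_locales
  let ?P = "\<Pi>\<^sub>M n\<in>I. Q"
  interpret MP: pair_prob_space M ?P ..
  obtain h where h: "h \<in> borel_measurable Z" "integrable Z h"
    and h_inv: "\<And>g. g \<in> carrier G \<Longrightarrow> AE z in Z. h (S g z) = h z"
    and h_k: "\<epsilon> \<le> (\<integral>x. h (x, k) \<partial>M)"
    using invariant_weight[OF k n phi] by blast
  define f where "f = (\<lambda>y. indicator A y - measure Q A)"
  define \<Phi> where "\<Phi> x y = (\<integral>m. h (x, m) * f (y m) \<partial>count_space I)" for x and y :: "nat \<Rightarrow> 'y"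
  have f_meas: "f \<in> borel_measurable Q"
    by (simp add: f_def)
  have \<Phi>_meas: "(\<lambda>z. \<Phi> (fst z) (snd z)) \<in> borel_measurable (M \<Otimes>\<^sub>M ?P)"
    unfolding \<Phi>_def
  proof (rule I.borel_measurable_lebesgue_integral)
    let ?R = "(M \<Otimes>\<^sub>M ?P) \<Otimes>\<^sub>M count_space I"
    have "(\<lambda>z. (fst (fst z), snd z)) \<in> measurable ?R Z"
      unfolding Z_def by measurable
    hence "(\<lambda>z. h (fst (fst z), snd z)) \<in> borel_measurable ?R"
      using h(1) by (rule measurable_compose)
    moreover have "(\<lambda>z. f (snd (fst z) (snd z))) \<in> borel_measurable ?R"
    proof (rule measurable_compose_countable'[where f = "\<lambda>m z. f (snd (fst z) m)" and g = snd and I = I])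
      fix m assume m: "m \<in> I"
      show "(\<lambda>z. f (snd (fst z) m)) \<in> borel_measurable ?R"
        by (rule measurable_compose[OF measurable_compose[OF measurable_compose[OF measurable_fst measurable_snd]
                measurable_component_singleton[OF m]] f_meas])
    qed simp_all
    ultimately show "(\<lambda>(z, m). h (fst z, m) * f (snd z m)) \<in> borel_measurable ?R"
      unfolding split_beta by (rule borel_measurable_times)
  qed
  have fibre_int: "AE x in M. integrable (count_space I) (\<lambda>m. h (x, m))"
    using MI.AE_integrable_fst'[of h] h(2) by (simp add: Z_def)
  have moments: "integrable ?P (\<Phi> x)" "(\<integral>y. \<Phi> x y \<partial>?P) = 0"
    "(\<integral>y. \<Phi> x y * f (y k) \<partial>?P) = h (x, k) * (measure Q A * (1 - measure Q A))"
    if "integrable (count_space I) (\<lambda>m. h (x, m))" for x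
    using weighted_coordinate_sum[OF Q A that k] by (simp_all add: \<Phi>_def[abs_def] f_def)
  have coord_inv: "AE y in ?P. \<forall>m\<in>I. \<forall>d\<in>carrier D. a d (y m) \<in> A \<longleftrightarrow> y m \<in> A"
  proof (subst AE_ball_countable[OF countableI_type], rule ballI)
    fix m assume m: "m \<in> I"
    have "AE y in Q. \<forall>d\<in>carrier D. a d y \<in> A \<longleftrightarrow> y \<in> A"
      using inv_A by (simp add: AE_ball_countable[OF countable_D])
    thus "AE y in ?P. \<forall>d\<in>carrier D. a d (y m) \<in> A \<longleftrightarrow> y m \<in> A"
      by (rule AE_PiM_component[OF Q m])
  qed
  let ?B = "coind_action D M \<alpha> \<beta> N C a"
  have \<Phi>_inv: "AE z in M \<Otimes>\<^sub>M ?P. ?B g z \<in> space (M \<Otimes>\<^sub>M ?P) \<and>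
      \<Phi> (fst (?B g z)) (snd (?B g z)) = \<Phi> (fst z) (snd z)" if g: "g \<in> carrier G" for g
  proof -
    have "AE x in M. AE m in count_space I. h (S g (x, m)) = h (x, m)"
      using h_inv[OF g] unfolding Z_def by (rule MI.AE_pair)
    hence hx: "AE x in M. \<forall>m\<in>I. h (S g (x, m)) = h (x, m)"
      by (simp add: AE_count_space)
    have "AE z in M \<Otimes>\<^sub>M ?P. fst z \<in> W \<and> (\<forall>m\<in>I. h (S g (fst z, m)) = h (fst z, m))"
      using W_conull hx by (intro AE_pair_fst PQ.P.sigma_finite_measure_axioms) simp
    moreover have "AE z in M \<Otimes>\<^sub>M ?P. \<forall>m\<in>I. \<forall>d\<in>carrier D. a d (snd z m) \<in> A \<longleftrightarrow> snd z m \<in> A"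
      by (intro AE_pair_snd PQ.P.sigma_finite_measure_axioms coord_inv)
    ultimately show ?thesis
      using AE_space
    proof eventually_elim
      case (elim z)
      obtain x y where z: "z = (x, y)"
        by (cases z)
      have x: "x \<in> W" and hS: "\<And>m. m \<in> I \<Longrightarrow> h (S g (x, m)) = h (x, m)"
        and yA: "\<And>m d. m \<in> I \<Longrightarrow> d \<in> carrier D \<Longrightarrow> a d (y m) \<in> A \<longleftrightarrow> y m \<in> A"
        and y: "y \<in> space ?P"
        using elim by (auto simp: z space_pair_measure)
      define y' where "y' = snd (?B g z)"
      have B: "?B g z = (\<beta> g x, y')"
        by (simp add: y'_def coind_action_def z)
      have y': "y' (P g x m) = a (coind_delta D M \<alpha> \<beta> N C g x (P g x m)) (y m)" if m: "m \<in> I" for m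
        using coind_perm_class(1)[OF x g m] coind_perm_inv[OF x g m]
        by (simp add: y'_def coind_action_def z)
      have a_space: "a d w \<in> space Q" if "d \<in> carrier D" "w \<in> space Q" for d w
        using a that measurable_space[of "a d" Q Q w] by (auto simp: pmp_action_def)
      have "y' n' \<in> space Q" if n': "n' \<in> I" for n'
      proof -
        obtain m where m: "m \<in> I" "n' = P g x m"
          using bij_betw_imp_surj_on[OF coind_perm_bij[OF x g]] n' by blast
        thus ?thesis
          using y'[OF m(1)] a_space[OF coind_delta_closed[OF x g m(1)]] y by (auto simp: space_PiM PiE_def Pi_def)
      qed
      moreover have "y' \<in> extensional I"
        by (simp add: y'_def coind_action_def z)
      ultimately have "y' \<in> space ?P"
        by (auto simp: space_PiM PiE_def)
      hence space: "?B g z \<in> space (M \<Otimes>\<^sub>M ?P)"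
        using W_space[OF W_invariant[OF g x]] by (simp add: B space_pair_measure)
      \<comment> \<open>The series for \<open>\<Phi>\<close> at the translated point, rearranged along the permutation.\<close>
      have "\<Phi> (\<beta> g x) y' = (\<integral>m. h (\<beta> g x, P g x m) * f (y' (P g x m)) \<partial>count_space I)"
        unfolding \<Phi>_def
        by (rule integral_bij_count_space[OF coind_perm_bij[OF x g], symmetric])
      also have "\<dots> = (\<integral>m. h (x, m) * f (y m) \<partial>count_space I)"
      proof (rule Bochner_Integration.integral_cong[OF refl])
        fix m assume "m \<in> space (count_space I)"
        hence m: "m \<in> I" by simp
        have "h (\<beta> g x, P g x m) = h (x, m)"
          using hS[OF m] x by (simp add: S_def perm_def)
        moreover have "f (y' (P g x m)) = f (y m)"
          using yA[OF m coind_delta_closed[OF x g m]] by (simp add: y'[OF m] f_def indicator_def)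
        ultimately show "h (\<beta> g x, P g x m) * f (y' (P g x m)) = h (x, m) * f (y m)"
          by simp
      qed
      finally have "\<Phi> (\<beta> g x) y' = \<Phi> x y"
        by (simp add: \<Phi>_def)
      thus ?case
        using space by (simp add: B) (simp add: z)
    qed
  qed
  define U where "U = {z \<in> space (M \<Otimes>\<^sub>M ?P). 0 < \<Phi> (fst z) (snd z)}"
  have U: "U \<in> sets (M \<Otimes>\<^sub>M ?P)"
    unfolding U_def using \<Phi>_meas by measurable
  have "AE z in M \<Otimes>\<^sub>M ?P. ?B g z \<in> U \<longleftrightarrow> z \<in> U" if "g \<in> carrier G" for g
    using \<Phi>_inv[OF that] AE_space by eventually_elim (simp add: U_def)
  hence "measure (M \<Otimes>\<^sub>M ?P) U = 0 \<or> measure (M \<Otimes>\<^sub>M ?P) U = 1"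
    using erg U unfolding ergodic_def coind_space_def by blast
  hence sign: "(AE z in M \<Otimes>\<^sub>M ?P. 0 \<le> - \<Phi> (fst z) (snd z)) \<or> (AE z in M \<Otimes>\<^sub>M ?P. 0 \<le> \<Phi> (fst z) (snd z))"
  proof
    assume "measure (M \<Otimes>\<^sub>M ?P) U = 0"
    hence "AE z in M \<Otimes>\<^sub>M ?P. z \<notin> U"
      using U by (intro AE_not_in) (simp add: null_sets_def MP.P.emeasure_eq_measure)
    hence "AE z in M \<Otimes>\<^sub>M ?P. 0 \<le> - \<Phi> (fst z) (snd z)"
      using AE_space by eventually_elim (auto simp: U_def)
    thus ?thesis ..
  next
    assume "measure (M \<Otimes>\<^sub>M ?P) U = 1"
    hence "AE z in M \<Otimes>\<^sub>M ?P. z \<in> U"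
      using MP.P.AE_prob_1 by blast
    hence "AE z in M \<Otimes>\<^sub>M ?P. 0 \<le> \<Phi> (fst z) (snd z)"
      by eventually_elim (auto simp: U_def)
    thus ?thesis ..
  qed
  have zero: "AE x in M. AE y in ?P. \<Phi> x y = 0"
    using sign
  proof
    assume "AE z in M \<Otimes>\<^sub>M ?P. 0 \<le> - \<Phi> (fst z) (snd z)"
    hence "AE x in M. AE y in ?P. 0 \<le> - \<Phi> x y"
      using MP.AE_pair by fastforce
    thus ?thesis
      using fibre_int
    proof eventually_elim
      case (elim x)
      thus ?case
        using integral_nonneg_eq_0_iff_AE[of ?P "\<lambda>y. - \<Phi> x y"] moments[OF elim(2)] by simp
    qed
  next
    assume "AE z in M \<Otimes>\<^sub>M ?P. 0 \<le> \<Phi> (fst z) (snd z)"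
    hence "AE x in M. AE y in ?P. 0 \<le> \<Phi> x y"
      using MP.AE_pair by fastforce
    thus ?thesis
      using fibre_int
    proof eventually_elim
      case (elim x)
      thus ?case
        using integral_nonneg_eq_0_iff_AE[of ?P "\<Phi> x"] moments[OF elim(2)] by simp
    qed
  qed
  have "AE x in M. h (x, k) * (measure Q A * (1 - measure Q A)) = 0"
    using zero fibre_int
  proof eventually_elim
    case (elim x)
    have "(\<integral>y. \<Phi> x y * f (y k) \<partial>?P) = 0"
      using elim(1) by (intro integral_eq_zero_AE) (auto elim: eventually_mono)
    thus ?case
      using moments(3)[OF elim(2)] by simp
  qed
  hence "(\<integral>x. h (x, k) * (measure Q A * (1 - measure Q A)) \<partial>M) = 0"
    by (rule integral_eq_zero_AE)
  hence "(\<integral>x. h (x, k) \<partial>M) * (measure Q A * (1 - measure Q A)) = 0"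
    by simp
  moreover have "(\<integral>x. h (x, k) \<partial>M) \<noteq> 0"
    using h_k \<epsilon> by linarith
  ultimately show "measure Q A = 0 \<or> measure Q A = 1"
    unfolding mult_eq_0_iff by linarith
qed

end

theorem proposition3p4:
  fixes G :: "('g, 'm) monoid_scheme" and D :: "('d, 'n) monoid_scheme"
    and M :: "'x measure" and Q :: "'y measure"
    and \<beta>\<^sub>0 :: "'g \<Rightarrow> 'x \<Rightarrow> 'x" and \<alpha>\<^sub>0 :: "'d \<Rightarrow> 'x \<Rightarrow> 'x" and a :: "'d \<Rightarrow> 'y \<Rightarrow> 'y"
    and E F :: "'x rel" and N :: enat and C :: "nat \<Rightarrow> 'x \<Rightarrow> 'x"
  assumes "group G" and "countable (carrier G)"
    and "group D" and "countable (carrier D)"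
    and "standard_prob_space M"
    and "pmp_action G M \<beta>\<^sub>0" and "F = orbit_rel G M \<beta>\<^sub>0"
    and "pmp_action D M \<alpha>\<^sub>0" and "free_action D M \<alpha>\<^sub>0" and "E = orbit_rel D M \<alpha>\<^sub>0"
    and "subrel_ae M E F"
    and "N \<ge> 1" and "has_index M E F N"
    and "choice_functions G D M \<alpha>\<^sub>0 \<beta>\<^sub>0 N C"
    and "\<exists>k\<in>index_set N. \<exists>n\<in>index_set N. (INF \<gamma>\<in>carrier G. phi_coeff M E \<beta>\<^sub>0 C k n \<gamma>) > 0"
    and "standard_prob_space Q" and "pmp_action D Q a"
    and "ergodic G (coind_space M Q N) (coind_action D M \<alpha>\<^sub>0 \<beta>\<^sub>0 N C a)"
  shows "ergodic D Q a"
proof -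
  define good where "good x \<longleftrightarrow> inj_on (\<lambda>n. C n x) (index_set N) \<and>
      transversal ((\<lambda>n. C n x) ` index_set N)
        (classes_below M (orbit_rel D M \<alpha>\<^sub>0) (orbit_rel G M \<beta>\<^sub>0) x) \<and>
      (\<forall>d\<in>carrier D. \<alpha>\<^sub>0 d x = x \<longrightarrow> d = \<one>\<^bsub>D\<^esub>)" for x
  have C_meas: "\<And>n. n \<in> index_set N \<Longrightarrow> C n \<in> measurable M M"
    and choice: "AE x in M. inj_on (\<lambda>n. C n x) (index_set N) \<and>
      transversal ((\<lambda>n. C n x) ` index_set N)
        (classes_below M (orbit_rel D M \<alpha>\<^sub>0) (orbit_rel G M \<beta>\<^sub>0) x)"
    using assms(14) unfolding choice_functions_def by blast+
  have "AE x in M. good x"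
    using choice assms(9)[unfolded free_action_def] by eventually_elim (simp add: good_def)
  then obtain W where W: "W \<in> sets M" "AE x in M. x \<in> W" "\<And>x. x \<in> W \<Longrightarrow> good x"
    "\<And>g x. g \<in> carrier G \<Longrightarrow> x \<in> W \<Longrightarrow> \<beta>\<^sub>0 g x \<in> W"
    using invariant_conull_subset[OF assms(1,2,6)] by blast
  interpret choice_system G D M \<alpha>\<^sub>0 \<beta>\<^sub>0 N C W
    by (intro choice_system.intro assms(1-6) assms(8) C_meas W)
       (use W(3) in \<open>auto simp: good_def\<close>)
  obtain k n where kn: "k \<in> index_set N" "n \<in> index_set N"
    and pos: "(INF \<gamma>\<in>carrier G. phi_coeff M E \<beta>\<^sub>0 C k n \<gamma>) > 0"
    using assms(15) by blast
  show ?thesis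
  proof (rule coinduced_ergodic_imp_ergodic[OF kn pos])
    fix g assume "g \<in> carrier G"
    thus "(INF \<gamma>\<in>carrier G. phi_coeff M E \<beta>\<^sub>0 C k n \<gamma>) \<le> phi_coeff M (orbit_rel D M \<alpha>\<^sub>0) \<beta>\<^sub>0 C k n g"
      unfolding assms(10)[symmetric]
      by (intro cINF_lower bdd_belowI2[where m = 0]) (simp_all add: phi_coeff_def)
  qed (use assms standard_prob_space_imp_prob_space in auto)
qed

end
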